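(* Let $\beta\in\mathbb{N}$ and $\lambda\ge2$ an integer, and let $H_n(\lambda,\beta,\gamma)$ denote the coefficient of $\frac{x^n}{n!}$ in $\frac{e^{\gamma x}}{(2-e^{\beta x})^{\lambda}}$. Then for every $n\in\mathbb{N}_0$, $$H_n(\lambda,\beta,0)=\frac{1}{2\beta(\lambda-1)}H_{n+1}(\lambda-1,\beta,0)+\frac12H_n(\lambda-1,\beta,0).$$ *)

theory Defs
  imports Complex_Main "HOL-Computational_Algebra.Formal_Power_Series"
begin

(* The generating function exp (g x) / (2 - exp (b x))^l as a formal power series over the reals.
   The denominator has constant coefficient 1, so the division is by a unit. *)
definition H_gf :: "nat \<Rightarrow> nat \<Rightarrow> real \<Rightarrow> real fps" where
  "H_gf l b g = fps_exp g / (2 - fps_exp (real b)) ^ l"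

(* The factor n! turns the coefficient of x^n into that of x^n / n!. *)
definition H :: "nat \<Rightarrow> nat \<Rightarrow> nat \<Rightarrow> real \<Rightarrow> real" where
  "H n l b g = fact n * fps_nth (H_gf l b g) n"

end

theory Submission
  imports Defs
begin

text \<open>With \<open>D = 2 - e\<^sup>\<beta>\<^sup>x\<close> one has \<open>D' = -\<beta> (2 - D)\<close>, so
  \<open>(D\<^sup>-\<^sup>m)' = m \<beta> (2 D\<^sup>-\<^sup>m\<^sup>-\<^sup>1 - D\<^sup>-\<^sup>m)\<close>; compare coefficients for \<open>m = \<lambda> - 1\<close>.\<close>

text \<open>Turns the quotient into a power of an inverse, to which the power rule applies.\<close>

lemma H_gf_zero: "H_gf l b 0 = inverse (2 - fps_exp (real b)) ^ l"
proof -
  have "fps_nth ((2 - fps_exp (real b)) ^ l) 0 \<noteq> 0"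
    by (simp add: fps_nth_power_0)
  then show ?thesis
    by (simp add: H_gf_def fps_divide_unit fps_inverse_power)
qed

lemma fps_deriv_H_gf_zero:
  "fps_deriv (H_gf m b 0) = fps_const (real m * real b) * (2 * H_gf (Suc m) b 0 - H_gf m b 0)"
proof (cases m)
  case (Suc k)
  define D where "D = 2 - fps_exp (real b)"
  have D0: "fps_nth D 0 \<noteq> 0"
    by (simp add: D_def)
  have deriv: "fps_deriv D = - fps_const (real b) * (2 - D)"
    by (simp add: D_def del: fps_const_neg)
  have inv: "inverse D * D = 1"
    using D0 by (rule inverse_mult_eq_1)
  have "fps_deriv (inverse D ^ m) = of_nat m * (- fps_deriv D * (inverse D)\<^sup>2) * inverse D ^ k"
    by (simp only: fps_deriv_power' fps_inverse_deriv[OF D0] Suc diff_Suc_1)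
  \<comment> \<open>One factor of \<open>(inverse D)\<^sup>2\<close> restores the power
    \<open>m\<close>; the other stays with \<open>2 - D\<close>.\<close>
  also have "\<dots> = of_nat m * fps_const (real b) * ((2 - D) * inverse D) * inverse D ^ m"
    by (simp add: deriv Suc power2_eq_square del: fps_const_neg)
  also have "(2 - D) * inverse D = 2 * inverse D - 1"
    using inv by (simp add: algebra_simps)
  also have "of_nat m * fps_const (real b) * (2 * inverse D - 1) * inverse D ^ m
      = fps_const (real m * real b) * (2 * inverse D ^ Suc m - inverse D ^ m)"
    by (simp add: algebra_simps fps_of_nat flip: fps_const_mult)
  finally show ?thesis
    by (simp add: H_gf_zero D_def)
qed (simp add: H_gf_zero)

theorem theorem11:
  fixes l b n :: nat
  assumes "b \<ge> 1" and "l \<ge> 2"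
  shows "H n l b 0 =
    1 / (2 * real b * (real l - 1)) * H (n + 1) (l - 1) b 0 + 1 / 2 * H n (l - 1) b 0"
proof -
  define m where "m = l - 1"
  have l: "l = Suc m" and m: "m > 0"
    using assms(2) by (auto simp: m_def)
  \<comment> \<open>Differentiation supplies the factor \<open>n + 1\<close> that turns
    \<open>fact n\<close> into \<open>fact (n + 1)\<close>.\<close>
  have "H (n + 1) m b 0 = fact n * fps_nth (fps_deriv (H_gf m b 0)) n"
    by (simp add: H_def)
  also have "\<dots> = real m * real b * (2 * H n l b 0 - H n m b 0)"
    by (simp add: fps_deriv_H_gf_zero H_def l numeral_fps_const right_diff_distrib)
  \<comment> \<open>Solve for \<open>H n l b 0\<close>; the divisor
    \<open>2 * real m * real b\<close> is nonzero.\<close>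
  finally show ?thesis
    using assms(1) m by (simp add: l field_simps)
qed

end
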